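(* Let $1<p<\infty$. Then every linear subspace of $\mathcal B(\ell_p)$ that contains $\mathcal F(\ell_p)$ (with the operator norm) has the UBCP.
   Context: $\mathcal B(\ell_p)$ is the space of bounded linear operators from $\ell_p$ to itself with the operator norm, and $\mathcal F(\ell_p)$ is its subspace of finite rank operators. A normed space $Z$ has the uniform ball-covering property (UBCP) if its unit sphere $S_Z=\{z:\|z\|=1\}$ can be covered by countably many balls $\{B_n\}$, none of which contains the origin, with bounded radii, and for which there exists an open ball $B_0$ containing the origin with $B_n\cap B_0=\emptyset$ for all $n$. *)

theory Defs
  imports "HOL-Analysis.Analysis" "HOL-Library.Function_Algebras"
begin

text \<open>
  The scalar field is a type \<open>'k\<close> of sort \<open>{real_normed_field, euclidean_space}\<close>. Both
  \<open>real\<close> and \<open>complex\<close> have this sort, and, up to isometric isomorphism, they are the only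
  such fields, so real and complex scalars are treated at once.

  Since the exponent \<open>p\<close> is a term, \<open>\<ell>\<^sub>p\<close> is a carrier set inside the type of all scalar
  sequences, and normed spaces are given by a carrier together with a norm function.
\<close>

definition seq_scale :: "'k::times \<Rightarrow> (nat \<Rightarrow> 'k) \<Rightarrow> (nat \<Rightarrow> 'k)" where
  "seq_scale c x = (\<lambda>n. c * x n)"

definition op_scale ::
    "'k::times \<Rightarrow> ((nat \<Rightarrow> 'k) \<Rightarrow> (nat \<Rightarrow> 'k)) \<Rightarrow> ((nat \<Rightarrow> 'k) \<Rightarrow> (nat \<Rightarrow> 'k))" where
  "op_scale c T = (\<lambda>x. seq_scale c (T x))"

lemma vector_space_seq_scale: "vector_space (seq_scale :: 'k::field \<Rightarrow> _)"
  by unfold_locales (auto simp: seq_scale_def fun_eq_iff algebra_simps)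

lemma vector_space_op_scale: "vector_space (op_scale :: 'k::field \<Rightarrow> _)"
  by unfold_locales (auto simp: op_scale_def seq_scale_def fun_eq_iff algebra_simps)

definition lp :: "real \<Rightarrow> (nat \<Rightarrow> 'k::real_normed_vector) set" where
  "lp p = {x. summable (\<lambda>n. norm (x n) powr p)}"

definition lp_norm :: "real \<Rightarrow> (nat \<Rightarrow> 'k::real_normed_vector) \<Rightarrow> real" where
  "lp_norm p x = (\<Sum>n. norm (x n) powr p) powr (1 / p)"

text \<open>
  An operator on \<open>\<ell>\<^sub>p\<close> is represented by a function on all sequences that vanishes off
  \<open>\<ell>\<^sub>p\<close>; this makes the representation unique, so that equality of operators is equality
  of functions.
\<close>

definition bounded_ops :: "real \<Rightarrow> ((nat \<Rightarrow> 'k::real_normed_field) \<Rightarrow> (nat \<Rightarrow> 'k)) set" where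
  "bounded_ops p = {T.
     (\<forall>x\<in>lp p. T x \<in> lp p) \<and>
     (\<forall>x\<in>lp p. \<forall>y\<in>lp p. T (x + y) = T x + T y) \<and>
     (\<forall>c. \<forall>x\<in>lp p. T (seq_scale c x) = seq_scale c (T x)) \<and>
     (\<exists>K. \<forall>x\<in>lp p. lp_norm p (T x) \<le> K * lp_norm p x) \<and>
     (\<forall>x. x \<notin> lp p \<longrightarrow> T x = 0)}"

definition op_norm :: "real \<Rightarrow> ((nat \<Rightarrow> 'k::real_normed_field) \<Rightarrow> (nat \<Rightarrow> 'k)) \<Rightarrow> real" where
  "op_norm p T = (SUP x\<in>{x \<in> lp p. lp_norm p x \<le> 1}. lp_norm p (T x))"

definition finite_rank_ops :: "real \<Rightarrow> ((nat \<Rightarrow> 'k::real_normed_field) \<Rightarrow> (nat \<Rightarrow> 'k)) set" where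
  "finite_rank_ops p =
     {T \<in> bounded_ops p. \<exists>B. finite B \<and> T ` lp p = module.span seq_scale B}"

definition nball :: "'a::minus set \<Rightarrow> ('a \<Rightarrow> real) \<Rightarrow> 'a \<Rightarrow> real \<Rightarrow> 'a set" where
  "nball Z N c r = {z \<in> Z. N (z - c) < r}"

text \<open>
  In the following definition \<open>Z\<close> with norm \<open>N\<close> is the normed space, and the pairs in \<open>C\<close> are
  the centres and radii of the covering balls. The balls are open; closed balls would give an
  equivalent property, because the gap around the origin allows the radii to be enlarged slightly.
\<close>

definition UBCP :: "'a::ab_group_add set \<Rightarrow> ('a \<Rightarrow> real) \<Rightarrow> bool" where
  "UBCP Z N \<longleftrightarrow> (\<exists>C :: ('a \<times> real) set.
     countable C \<and>
     (\<forall>(c, r)\<in>C. c \<in> Z \<and> 0 < r) \<and>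
     {z \<in> Z. N z = 1} \<subseteq> (\<Union>(c, r)\<in>C. nball Z N c r) \<and>
     (\<forall>(c, r)\<in>C. 0 \<notin> nball Z N c r) \<and>
     (\<exists>R. \<forall>(c, r)\<in>C. r \<le> R) \<and>
     (\<exists>c0\<in>Z. \<exists>r0>0. 0 \<in> nball Z N c0 r0 \<and>
        (\<forall>(c, r)\<in>C. nball Z N c r \<inter> nball Z N c0 r0 = {})))"

end

theory Submission
  imports Defs
begin

text \<open>
  Let \<open>P\<close> be the projection of \<open>\<ell>\<^sub>p\<close> onto its first \<open>n\<close> coordinates and let \<open>\<parallel>T\<parallel> = 1\<close>. Then
  \<open>T - 2PTP = (I - P)T + PT(I - 2P)\<close>, the two summands have disjointly supported values, and
  \<open>I - 2P\<close> is an isometry, so \<open>\<parallel>T - 2PTP\<parallel> \<le> 2 powr (1/p) < 2\<close>. On the other hand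
  \<open>\<parallel>2PTP\<parallel>\<close> tends to \<open>2\<close> as \<open>n\<close> grows. Hence \<open>T\<close> is much closer to \<open>2PTP\<close> than \<open>0\<close> is, and
  this persists when the matrix \<open>2PTP\<close> is replaced by a nearby one with entries in a countable
  dense set of scalars.
\<close>

section \<open>The sequence space\<close>

text \<open>Convexity of the \<open>p\<close>-th power on the closed half-line. If \<open>u\<close>
  or \<open>v\<close> is zero it reduces to \<open>c powr p \<le> c\<close> for \<open>c\<close>
  between 0 and 1; otherwise \<open>powr_convex\<close> applies.\<close>

lemma powr_convex_combination:
  fixes u v a b :: real
  assumes "1 \<le> p" "0 \<le> u" "0 \<le> v" "0 \<le> a" "0 \<le> b" "a + b = 1"
  shows "(a * u + b * v) powr p \<le> a * u powr p + b * v powr p"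
proof -
  have le: "c powr p \<le> c" if "0 \<le> c" "c \<le> 1" for c :: real
    using powr_mono'[of 1 p c] that assms(1) by (cases "c = 0") auto
  consider "u = 0" | "v = 0" | "0 < u" "0 < v"
    using assms by force
  then show ?thesis
  proof cases
    case 1
    then show ?thesis
      using assms le[of b] by (auto simp: powr_mult intro!: mult_right_mono)
  next
    case 2
    then show ?thesis
      using assms le[of a] by (auto simp: powr_mult intro!: mult_right_mono)
  next
    case 3
    then show ?thesis
      using powr_convex[OF assms(1)] assms unfolding convex_on_def by auto
  qed
qed

lemma lp_norm_nonneg: "0 \<le> lp_norm p x"
  by (simp add: lp_norm_def)

lemma lp_norm_powr:
  assumes "0 < p" "x \<in> lp p"
  shows "lp_norm p x powr p = (\<Sum>n. norm (x n) powr p)"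
  using assms by (simp add: lp_norm_def lp_def powr_powr suminf_nonneg)

text \<open>Norm bounds can thus be checked on \<open>p\<close>-th powers, where sums over
  coordinates can be compared and split.\<close>

lemma lp_norm_leI:
  assumes "0 < p" "x \<in> lp p" "0 \<le> b" "(\<Sum>n. norm (x n) powr p) \<le> b powr p"
  shows "lp_norm p x \<le> b"
  using powr_less_mono2[of p b "lp_norm p x"] lp_norm_powr[OF assms(1,2)] assms by linarith

lemma lp_comparison:
  assumes "0 < p" "y \<in> lp p" "\<And>i. norm (x i) \<le> norm (y i)"
  shows "x \<in> lp p" "lp_norm p x \<le> lp_norm p y"
proof -
  have le: "norm (x i) powr p \<le> norm (y i) powr p" for i
    using assms by (intro powr_mono2) auto
  have sy: "summable (\<lambda>i. norm (y i) powr p)"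
    using assms(2) by (simp add: lp_def)
  then have sx: "summable (\<lambda>i. norm (x i) powr p)"
    by (rule summable_comparison_test'[of _ 0]) (simp add: le)
  then show "x \<in> lp p"
    by (simp add: lp_def)
  then show "lp_norm p x \<le> lp_norm p y"
    using suminf_le[OF le sx sy] lp_norm_powr[OF assms(1,2)] assms(1)
    by (intro lp_norm_leI) (auto simp: lp_norm_nonneg)
qed

lemma norm_coord_le_lp_norm:
  assumes "0 < p" "x \<in> lp p"
  shows "norm (x i) \<le> lp_norm p x"
proof -
  have "(\<Sum>k\<in>{i}. norm (x k) powr p) \<le> (\<Sum>k. norm (x k) powr p)"
    using assms by (intro sum_le_suminf) (auto simp: lp_def)
  then have "norm (x i) powr p \<le> lp_norm p x powr p"
    using lp_norm_powr[OF assms] by simp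
  then show ?thesis
    using powr_less_mono2[of p "lp_norm p x" "norm (x i)"] assms lp_norm_nonneg[of p x] by linarith
qed

lemma zero_in_lp: "0 \<in> lp p" and lp_norm_zero: "lp_norm p 0 = 0"
  by (simp_all add: lp_def lp_norm_def)

lemma lp_scale:
  fixes x :: "nat \<Rightarrow> 'k::real_normed_field"
  assumes "0 < p" "x \<in> lp p"
  shows "seq_scale c x \<in> lp p" "lp_norm p (seq_scale c x) = norm c * lp_norm p x"
proof -
  have s: "summable (\<lambda>i. norm (x i) powr p)"
    using assms(2) by (simp add: lp_def)
  then show "seq_scale c x \<in> lp p"
    by (simp add: lp_def seq_scale_def norm_mult powr_mult summable_mult)
  show "lp_norm p (seq_scale c x) = norm c * lp_norm p x"
    using s assms(1)
    by (simp add: lp_norm_def seq_scale_def norm_mult powr_mult suminf_mult suminf_nonneg powr_powr)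
qed

text \<open>Minkowski's inequality from convexity: with \<open>s = a + b\<close>, the vector (x +
  y)/s is the convex combination of x/a and y/b with weights a/s and b/s.\<close>

lemma lp_triangle:
  assumes "1 \<le> p" "x \<in> lp p" "y \<in> lp p"
  shows "x + y \<in> lp p" "lp_norm p (x + y) \<le> lp_norm p x + lp_norm p y"
proof -
  have p: "0 < p"
    using assms(1) by simp
  have sx: "summable (\<lambda>i. norm (x i) powr p)" and sy: "summable (\<lambda>i. norm (y i) powr p)"
    using assms by (auto simp: lp_def)
  \<comment> \<open>Strict upper bounds \<open>a\<close>, \<open>b\<close> are positive even when
    \<open>x\<close> or \<open>y\<close> is zero, so dividing by them is safe; at the end they are
    lowered to the norms.\<close>
  have main: "x + y \<in> lp p \<and> lp_norm p (x + y) \<le> a + b"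
    if a: "lp_norm p x < a" and b: "lp_norm p y < b" for a b
  proof -
    have pos: "0 < a" "0 < b"
      using a b lp_norm_nonneg[of p x] lp_norm_nonneg[of p y] by linarith+
    define s where "s = a + b"
    \<comment> \<open>The majorant that convexity yields. Its sum is explicit, so it gives both
      membership in \<open>lp p\<close> and the norm bound.\<close>
    define f where "f = (\<lambda>i. s powr p * (a / s * (norm (x i) powr p / a powr p)
      + b / s * (norm (y i) powr p / b powr p)))"
    have le: "norm ((x + y) i) powr p \<le> f i" for i
    proof -
      have "norm ((x + y) i) powr p \<le> (norm (x i) + norm (y i)) powr p"
        using p by (intro powr_mono2) (auto simp: norm_triangle_ineq)
      also have "norm (x i) + norm (y i) = s * (a / s * (norm (x i) / a) + b / s * (norm (y i) / b))"
        using pos by (simp add: s_def distrib_left)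
      also have "\<dots> powr p = s powr p * (a / s * (norm (x i) / a) + b / s * (norm (y i) / b)) powr p"
        using pos by (subst powr_mult) (auto simp: s_def)
      also have "\<dots> \<le> s powr p * (a / s * (norm (x i) / a) powr p + b / s * (norm (y i) / b) powr p)"
        using pos assms(1)
        by (intro mult_left_mono powr_convex_combination) (auto simp: s_def add_divide_distrib [symmetric])
      also have "\<dots> = f i"
        using pos by (simp add: f_def powr_divide)
      finally show ?thesis .
    qed
    have fs: "f sums (s powr p * (a / s * (lp_norm p x powr p / a powr p)
      + b / s * (lp_norm p y powr p / b powr p)))"
      unfolding f_def lp_norm_powr[OF p assms(2)] lp_norm_powr[OF p assms(3)]
      by (intro sums_mult sums_add sums_divide summable_sums sx sy)
    have "summable (\<lambda>i. norm ((x + y) i) powr p)"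
      using sums_summable[OF fs] by (rule summable_comparison_test'[of _ 0]) (use le in simp)
    then have xy: "x + y \<in> lp p"
      by (simp add: lp_def)
    have "(\<Sum>i. norm ((x + y) i) powr p) \<le> suminf f"
      using le sums_summable[OF fs] xy by (intro suminf_le) (auto simp: lp_def)
    also have "suminf f = s powr p * (a / s * (lp_norm p x powr p / a powr p)
      + b / s * (lp_norm p y powr p / b powr p))"
      using sums_unique[OF fs] by simp
    also have "\<dots> \<le> s powr p * (a / s * 1 + b / s * 1)"
      using pos p a b lp_norm_nonneg[of p x] lp_norm_nonneg[of p y]
      by (intro mult_left_mono add_mono) (auto simp: s_def intro!: powr_mono2)
    also have "\<dots> = s powr p"
      using pos by (simp add: s_def add_divide_distrib[symmetric])
    finally show ?thesis
      using xy p pos by (auto simp: s_def intro!: lp_norm_leI)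
  qed
  show "x + y \<in> lp p"
    using main[of "lp_norm p x + 1" "lp_norm p y + 1"] by simp
  show "lp_norm p (x + y) \<le> lp_norm p x + lp_norm p y"
  proof (rule field_le_epsilon)
    fix e :: real assume "0 < e"
    then show "lp_norm p (x + y) \<le> lp_norm p x + lp_norm p y + e"
      using main[of "lp_norm p x + e / 2" "lp_norm p y + e / 2"] by simp
  qed
qed

lemma lp_diff:
  assumes "1 \<le> p" "x \<in> lp p" "y \<in> lp p"
  shows "x - y \<in> lp p" "lp_norm p (x - y) \<le> lp_norm p x + lp_norm p y"
proof -
  have "- y \<in> lp p" "lp_norm p (- y) = lp_norm p y"
    using assms(3) by (simp_all add: lp_def lp_norm_def)
  then show "x - y \<in> lp p" "lp_norm p (x - y) \<le> lp_norm p x + lp_norm p y"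
    using lp_triangle[OF assms(1,2), of "- y"] by simp_all
qed

lemma lp_norm_diff_ge:
  assumes "1 \<le> p" "x \<in> lp p" "y \<in> lp p"
  shows "lp_norm p x - lp_norm p y \<le> lp_norm p (x - y)"
  using lp_triangle(2)[OF assms(1) lp_diff(1)[OF assms] assms(3)] by simp

section \<open>Truncation\<close>

text \<open>The projection \<open>P\<close> of the overview, defined on all sequences.\<close>

definition trunc :: "nat \<Rightarrow> (nat \<Rightarrow> 'a::zero) \<Rightarrow> nat \<Rightarrow> 'a" where
  "trunc n x = (\<lambda>i. if i < n then x i else 0)"

definition basis_seq :: "nat \<Rightarrow> nat \<Rightarrow> 'a::zero_neq_one" where
  "basis_seq j = (\<lambda>i. if i = j then 1 else 0)"

lemma trunc_in_lp: "trunc n x \<in> lp p"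
  unfolding lp_def mem_Collect_eq by (rule summable_finite[of "{..<n}"]) (auto simp: trunc_def)

lemma trunc_diff: "trunc n (x - y) = trunc n x - trunc n (y :: nat \<Rightarrow> 'a::ab_group_add)"
  by (auto simp: trunc_def)

lemma trunc_Suc:
  fixes x :: "nat \<Rightarrow> 'k::real_normed_field"
  shows "trunc (Suc n) x = trunc n x + seq_scale (x n) (basis_seq n)"
  by (auto simp: trunc_def seq_scale_def basis_seq_def fun_eq_iff less_Suc_eq)

lemma trunc_0: "trunc 0 x = 0"
  by (auto simp: trunc_def)

lemma basis_seq_in_lp: "basis_seq j \<in> lp p"
  unfolding lp_def mem_Collect_eq by (rule summable_finite[of "{j}"]) (auto simp: basis_seq_def)

lemma lp_norm_basis_seq: "lp_norm p (basis_seq j :: nat \<Rightarrow> 'k::real_normed_field) = 1"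
  unfolding lp_norm_def by (subst suminf_finite[of "{j}"]) (auto simp: basis_seq_def)

lemma lp_norm_trunc_le:
  assumes "0 < p" "x \<in> lp p"
  shows "lp_norm p (trunc n x) \<le> lp_norm p x"
  by (rule lp_comparison(2)[OF assms]) (simp add: trunc_def)

text \<open>\<open>I - 2P\<close> only flips the signs of the first \<open>n\<close>
  coordinates.\<close>

lemma lp_norm_reflection:
  fixes x :: "nat \<Rightarrow> 'k::real_normed_field"
  shows "lp_norm p (x - seq_scale 2 (trunc n x)) = lp_norm p x"
proof -
  have "norm ((x - seq_scale 2 (trunc n x)) i) = norm (x i)" for i
    using norm_minus_cancel[of "x i"] by (simp add: trunc_def seq_scale_def)
  then show ?thesis
    by (simp add: lp_norm_def)
qed

text \<open>At each index at most one of the two entries is nonzero, so the \<open>p\<close>-th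
  powers of the moduli add. This is sharper than the triangle inequality and is what brings the
  constant below 2.\<close>

lemma lp_norm_add_disjoint_powr:
  assumes "0 < p" "x \<in> lp p" "y \<in> lp p" "\<And>i. x i = 0 \<or> y i = 0"
  shows "lp_norm p (x + y) powr p = lp_norm p x powr p + lp_norm p y powr p"
proof -
  have eq: "norm ((x + y) i) powr p = norm (x i) powr p + norm (y i) powr p" for i
    using assms(4)[of i] by auto
  have s: "summable (\<lambda>i. norm (x i) powr p)" "summable (\<lambda>i. norm (y i) powr p)"
    using assms by (auto simp: lp_def)
  then have xy: "x + y \<in> lp p"
    unfolding lp_def mem_Collect_eq eq by (rule summable_add)
  show ?thesis
    unfolding lp_norm_powr[OF assms(1,2)] lp_norm_powr[OF assms(1,3)] lp_norm_powr[OF assms(1) xy] eq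
    by (rule suminf_add[OF s, symmetric])
qed

text \<open>By disjointness of supports, the \<open>p\<close>-th power of the tail norm is the full
  sum minus a partial sum.\<close>

lemma lp_norm_trunc_tendsto:
  assumes "1 \<le> p" "x \<in> lp p"
  shows "(\<lambda>n. lp_norm p (x - trunc n x)) \<longlonglongrightarrow> 0"
proof -
  have p: "0 < p"
    using assms(1) by simp
  have s: "summable (\<lambda>i. norm (x i) powr p)"
    using assms by (auto simp: lp_def)
  define S where "S = (\<Sum>i. norm (x i) powr p)"
  have eq: "(\<Sum>i. norm ((x - trunc n x) i) powr p) = S - (\<Sum>i<n. norm (x i) powr p)" for n
  proof -
    have t: "x - trunc n x \<in> lp p"
      by (rule lp_diff(1)[OF assms trunc_in_lp])
    have "lp_norm p ((x - trunc n x) + trunc n x) powr p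
      = lp_norm p (x - trunc n x) powr p + lp_norm p (trunc n x) powr p"
      by (rule lp_norm_add_disjoint_powr[OF p t trunc_in_lp]) (simp add: trunc_def)
    moreover have "(\<Sum>i. norm (trunc n x i) powr p) = (\<Sum>i<n. norm (x i) powr p)"
      by (subst suminf_finite[of "{..<n}"]) (auto simp: trunc_def)
    ultimately show ?thesis
      by (simp add: lp_norm_powr[OF p t] lp_norm_powr[OF p trunc_in_lp] lp_norm_powr[OF p assms(2)]
        S_def)
  qed
  \<comment> \<open>The base tends to 0; continuity of the power there rests on a nonnegative base
    and the positive exponent \<open>1 / p\<close>.\<close>
  have "(\<lambda>n. (S - (\<Sum>i<n. norm (x i) powr p)) powr (1 / p)) \<longlonglongrightarrow> (S - S) powr (1 / p)"
  proof (rule tendsto_powr2)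
    show "(\<lambda>n. S - (\<Sum>i<n. norm (x i) powr p)) \<longlonglongrightarrow> S - S"
      unfolding S_def by (intro tendsto_diff tendsto_const summable_LIMSEQ s)
    show "\<forall>\<^sub>F n in sequentially. 0 \<le> S - (\<Sum>i<n. norm (x i) powr p)"
      unfolding S_def by (intro always_eventually allI) (simp add: sum_le_suminf s)
  qed (use p in auto)
  then show ?thesis
    unfolding lp_norm_def eq by simp
qed

text \<open>Splitting off one basis vector at a time gives this crude bound, which is enough to
  control a finite matrix by its entries.\<close>

lemma lp_norm_trunc_le_sum:
  fixes x :: "nat \<Rightarrow> 'k::real_normed_field"
  assumes "1 \<le> p"
  shows "lp_norm p (trunc n x) \<le> (\<Sum>i<n. norm (x i))"
proof (induction n)
  case 0
  show "lp_norm p (trunc 0 x) \<le> (\<Sum>i<0. norm (x i))"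
    by (simp add: trunc_0 lp_norm_zero)
next
  case (Suc n)
  have p: "0 < p"
    using assms by simp
  show "lp_norm p (trunc (Suc n) x) \<le> (\<Sum>i<Suc n. norm (x i))"
    unfolding trunc_Suc
    using lp_triangle(2)[OF assms trunc_in_lp[of n x p] lp_scale(1)[OF p basis_seq_in_lp, of "x n" n]]
      lp_scale(2)[OF p basis_seq_in_lp, of "x n" n] Suc
    by (simp add: lp_norm_basis_seq)
qed

section \<open>The operator norm\<close>

lemma bounded_opsD:
  assumes "T \<in> bounded_ops p"
  shows "x \<in> lp p \<Longrightarrow> T x \<in> lp p"
    and "x \<in> lp p \<Longrightarrow> y \<in> lp p \<Longrightarrow> T (x + y) = T x + T y"
    and "x \<in> lp p \<Longrightarrow> T (seq_scale c x) = seq_scale c (T x)"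
    and "x \<notin> lp p \<Longrightarrow> T x = 0"
  using assms by (auto simp: bounded_ops_def)

lemma bounded_opsI:
  assumes "\<And>x. x \<in> lp p \<Longrightarrow> T x \<in> lp p"
    and "\<And>x y. x \<in> lp p \<Longrightarrow> y \<in> lp p \<Longrightarrow> T (x + y) = T x + T y"
    and "\<And>c x. x \<in> lp p \<Longrightarrow> T (seq_scale c x) = seq_scale c (T x)"
    and "\<And>x. x \<in> lp p \<Longrightarrow> lp_norm p (T x) \<le> K * lp_norm p x"
    and "\<And>x. x \<notin> lp p \<Longrightarrow> T x = 0"
  shows "T \<in> bounded_ops p"
  using assms unfolding bounded_ops_def by blast

lemma bounded_ops_zero:
  assumes "T \<in> bounded_ops p"
  shows "T 0 = 0"
  using bounded_opsD(2)[OF assms zero_in_lp zero_in_lp] by simp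

lemma bounded_ops_diff_arg:
  fixes T :: "(nat \<Rightarrow> 'k::real_normed_field) \<Rightarrow> (nat \<Rightarrow> 'k)"
  assumes "1 \<le> p" "T \<in> bounded_ops p" "x \<in> lp p" "y \<in> lp p"
  shows "T (x - y) = T x - T y"
  using bounded_opsD(2)[OF assms(2) lp_diff(1)[OF assms(1,3,4)] assms(4)] by simp

lemma lp_norm_le_op_norm:
  assumes "T \<in> bounded_ops p" "x \<in> lp p" "lp_norm p x \<le> 1"
  shows "lp_norm p (T x) \<le> op_norm p T"
proof -
  obtain K where K: "\<And>x. x \<in> lp p \<Longrightarrow> lp_norm p (T x) \<le> K * lp_norm p x"
    using assms(1) unfolding bounded_ops_def by blast
  \<comment> \<open>The sign of \<open>K\<close> is unknown, hence the absolute value. The bound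
    makes the supremum in \<open>op_norm\<close> meaningful.\<close>
  have "lp_norm p (T x) \<le> \<bar>K\<bar>" if "x \<in> lp p" "lp_norm p x \<le> 1" for x
  proof -
    have "K * lp_norm p x \<le> \<bar>K\<bar> * 1"
      using that lp_norm_nonneg[of p x] by (intro mult_mono) auto
    then show ?thesis
      using K[OF that(1)] by simp
  qed
  then have "bdd_above ((\<lambda>x. lp_norm p (T x)) ` {x \<in> lp p. lp_norm p x \<le> 1})"
    by (auto intro!: bdd_aboveI)
  then show ?thesis
    unfolding op_norm_def using assms(2,3) by (intro cSUP_upper) auto
qed

lemma lp_norm_le_op_norm_mult:
  assumes "0 < p" "T \<in> bounded_ops p" "x \<in> lp p"
  shows "lp_norm p (T x) \<le> op_norm p T * lp_norm p x"
proof (cases "lp_norm p x = 0")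
  \<comment> \<open>Such an \<open>x\<close> cannot be normalised; the constant \<open>K\<close>
    from the definition of boundedness forces \<open>T x\<close> to have norm 0 as well.\<close>
  case True
  obtain K where "\<And>x. x \<in> lp p \<Longrightarrow> lp_norm p (T x) \<le> K * lp_norm p x"
    using assms(2) unfolding bounded_ops_def by blast
  then show ?thesis
    using True assms(3) by fastforce
next
  case False
  define c :: 'a where "c = of_real (inverse (lp_norm p x))"
  have pos: "0 < lp_norm p x"
    using False lp_norm_nonneg[of p x] by simp
  then have c: "norm c = inverse (lp_norm p x)"
    by (simp add: c_def norm_inverse)
  have "lp_norm p (T (seq_scale c x)) \<le> op_norm p T"
    using pos by (intro lp_norm_le_op_norm assms lp_scale) (simp add: lp_scale(2)[OF assms(1,3)] c)
  then have "inverse (lp_norm p x) * lp_norm p (T x) \<le> op_norm p T"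
    using bounded_opsD(1,3)[OF assms(2,3)] by (simp add: lp_scale(2)[OF assms(1)] c)
  then show ?thesis
    using pos by (simp add: field_simps)
qed

lemma op_norm_leI:
  assumes "\<And>x. x \<in> lp p \<Longrightarrow> lp_norm p x \<le> 1 \<Longrightarrow> lp_norm p (T x) \<le> b"
  shows "op_norm p T \<le> b"
  unfolding op_norm_def
  using zero_in_lp[of p] assms by (intro cSUP_least) (auto simp: lp_norm_zero)

lemma op_norm_zero: "op_norm p 0 = 0"
proof -
  have "(\<lambda>x. lp_norm p ((0 :: (nat \<Rightarrow> 'a::real_normed_field) \<Rightarrow> nat \<Rightarrow> 'a) x)) ` {x \<in> lp p. lp_norm p x \<le> 1} = {0}"
    using zero_in_lp[of p] lp_norm_zero[of p] by (auto simp: image_iff lp_norm_zero intro!: exI[of _ 0])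
  then show ?thesis
    by (simp add: op_norm_def)
qed

lemma op_norm_less_obtain:
  assumes "b < op_norm p T"
  obtains x where "x \<in> lp p" "lp_norm p x \<le> 1" "b < lp_norm p (T x)"
  using op_norm_leI[of p T b] assms by force

lemma bounded_ops_diff:
  fixes S T :: "(nat \<Rightarrow> 'k::real_normed_field) \<Rightarrow> (nat \<Rightarrow> 'k)"
  assumes "1 \<le> p" "S \<in> bounded_ops p" "T \<in> bounded_ops p"
  shows "S - T \<in> bounded_ops p"
proof -
  have p: "0 < p"
    using assms(1) by simp
  show ?thesis
  proof (rule bounded_opsI)
    fix x :: "nat \<Rightarrow> 'k" assume x: "x \<in> lp p"
    note ST = bounded_opsD(1)[OF assms(2) x] bounded_opsD(1)[OF assms(3) x]
    show "(S - T) x \<in> lp p"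
      using lp_diff(1)[OF assms(1) ST] by simp
    show "lp_norm p ((S - T) x) \<le> (op_norm p S + op_norm p T) * lp_norm p x"
      using lp_diff(2)[OF assms(1) ST] lp_norm_le_op_norm_mult[OF p assms(2) x]
        lp_norm_le_op_norm_mult[OF p assms(3) x]
      by (simp add: distrib_right)
    show "(S - T) (seq_scale c x) = seq_scale c ((S - T) x)" for c
      using x by (simp add: bounded_opsD(3)[OF assms(2)] bounded_opsD(3)[OF assms(3)])
        (simp add: seq_scale_def fun_eq_iff right_diff_distrib)
  qed (simp_all add: bounded_opsD[OF assms(2)] bounded_opsD[OF assms(3)])
qed

text \<open>From \<open>T = S - (S - T)\<close>. With \<open>T\<close> the centre of a covering ball
  and \<open>S\<close> a point in it, this bounds the norm of \<open>S\<close> from below.\<close>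

lemma op_norm_triangle:
  fixes S T :: "(nat \<Rightarrow> 'k::real_normed_field) \<Rightarrow> (nat \<Rightarrow> 'k)"
  assumes "1 \<le> p" "S \<in> bounded_ops p" "T \<in> bounded_ops p"
  shows "op_norm p T \<le> op_norm p S + op_norm p (S - T)"
proof (rule op_norm_leI)
  fix x :: "nat \<Rightarrow> 'k" assume x: "x \<in> lp p" "lp_norm p x \<le> 1"
  have ST: "S - T \<in> bounded_ops p"
    by (rule bounded_ops_diff[OF assms])
  have "T x = S x - (S - T) x"
    by simp
  then have "lp_norm p (T x) \<le> lp_norm p (S x) + lp_norm p ((S - T) x)"
    using lp_diff(2)[OF assms(1) bounded_opsD(1)[OF assms(2) x(1)] bounded_opsD(1)[OF ST x(1)]]
    by simp
  then show "lp_norm p (T x) \<le> op_norm p S + op_norm p (S - T)"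
    using lp_norm_le_op_norm[OF assms(2) x] lp_norm_le_op_norm[OF ST x] by linarith
qed

section \<open>Matrix operators\<close>

text \<open>The value 0 off \<open>lp p\<close> follows the convention of
  \<open>bounded_ops\<close>. Entries are indexed by pairs so that the matrices with entries in a
  countable set form a countable \<open>PiE\<close> over a finite square.\<close>

definition mat_op :: "real \<Rightarrow> nat \<Rightarrow> (nat \<times> nat \<Rightarrow> 'k::real_normed_field) \<Rightarrow> (nat \<Rightarrow> 'k) \<Rightarrow> nat \<Rightarrow> 'k"
  where "mat_op p n m x = (if x \<in> lp p then trunc n (\<lambda>i. \<Sum>j<n. m (i, j) * x j) else 0)"

lemma lp_norm_mat_op_le:
  assumes "1 \<le> p" "x \<in> lp p"
  shows "lp_norm p (mat_op p n m x) \<le> (\<Sum>i<n. \<Sum>j<n. norm (m (i, j))) * lp_norm p x"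
proof -
  have "lp_norm p (mat_op p n m x) \<le> (\<Sum>i<n. norm (\<Sum>j<n. m (i, j) * x j))"
    using assms(2) lp_norm_trunc_le_sum[OF assms(1)] by (simp add: mat_op_def)
  also have "\<dots> \<le> (\<Sum>i<n. \<Sum>j<n. norm (m (i, j)) * lp_norm p x)"
    using assms
    by (intro sum_mono sum_norm_le) (auto simp: norm_mult intro!: mult_left_mono norm_coord_le_lp_norm)
  finally show ?thesis
    by (simp add: sum_distrib_right)
qed

lemma mat_op_in_bounded_ops:
  fixes m :: "nat \<times> nat \<Rightarrow> 'k::real_normed_field"
  assumes "1 \<le> p"
  shows "mat_op p n m \<in> bounded_ops p"
proof -
  have p: "0 < p"
    using assms by simp
  show ?thesis
  proof (rule bounded_opsI[OF _ _ _ lp_norm_mat_op_le[OF assms]])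
    fix x y :: "nat \<Rightarrow> 'k" and c assume x: "x \<in> lp p"
    show "mat_op p n m x \<in> lp p"
      using x by (simp add: mat_op_def trunc_in_lp)
    show "mat_op p n m (seq_scale c x) = seq_scale c (mat_op p n m x)"
      unfolding mat_op_def using x lp_scale(1)[OF p x, of c]
      by (simp add: trunc_def seq_scale_def fun_eq_iff sum_distrib_left algebra_simps)
    assume y: "y \<in> lp p"
    show "mat_op p n m (x + y) = mat_op p n m x + mat_op p n m y"
      unfolding mat_op_def using x y lp_triangle(1)[OF assms x y]
      by (simp add: trunc_def fun_eq_iff sum.distrib algebra_simps)
  qed (auto simp: mat_op_def)
qed

text \<open>Linearity, one coordinate at a time: on truncated sequences an operator is determined by
  its values at the basis vectors.\<close>

lemma bounded_ops_trunc:
  fixes T :: "(nat \<Rightarrow> 'k::real_normed_field) \<Rightarrow> (nat \<Rightarrow> 'k)"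
  assumes "1 \<le> p" "T \<in> bounded_ops p"
  shows "T (trunc n x) = (\<Sum>j<n. seq_scale (x j) (T (basis_seq j)))"
proof (induction n)
  case 0
  show "T (trunc 0 x) = (\<Sum>j<0. seq_scale (x j) (T (basis_seq j)))"
    by (simp add: trunc_0 bounded_ops_zero[OF assms(2)])
next
  case (Suc n)
  then show "T (trunc (Suc n) x) = (\<Sum>j<Suc n. seq_scale (x j) (T (basis_seq j)))"
    using assms(1)
    by (simp add: trunc_Suc bounded_opsD(2,3)[OF assms(2)] trunc_in_lp lp_scale basis_seq_in_lp)
qed

lemma mat_op_trunc:
  assumes "x \<in> lp p"
  shows "mat_op p n m (trunc n x) = mat_op p n m x"
  using assms by (simp add: mat_op_def trunc_in_lp) (simp add: trunc_def)

lemma sum_fun_apply: "(\<Sum>j\<in>A. f j) i = (\<Sum>j\<in>A. f j i :: 'b::comm_monoid_add)"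
  by (induction A rule: infinite_finite_induct) auto

text \<open>Identifies the compression \<open>PTP\<close> with the upper left corner of the matrix
  of \<open>T\<close>.\<close>

lemma trunc_op_trunc_eq_mat_op:
  fixes T :: "(nat \<Rightarrow> 'k::real_normed_field) \<Rightarrow> (nat \<Rightarrow> 'k)"
  assumes "1 \<le> p" "T \<in> bounded_ops p" "x \<in> lp p"
  shows "trunc n (T (trunc n x)) = mat_op p n (\<lambda>(i, j). T (basis_seq j) i) x"
  using assms(3) unfolding bounded_ops_trunc[OF assms(1,2)] mat_op_def
  by (simp add: trunc_def sum_fun_apply seq_scale_def mult.commute fun_eq_iff)

text \<open>\<open>finite_rank_ops\<close> asks for a range equal to a finite span. The images of
  the first \<open>n\<close> basis vectors span the range because later coordinates are ignored, and
  the range contains their span because it is a subspace.\<close>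

lemma mat_op_in_finite_rank_ops:
  fixes m :: "nat \<times> nat \<Rightarrow> 'k::real_normed_field"
  assumes "1 \<le> p"
  shows "mat_op p n m \<in> finite_rank_ops p"
proof -
  interpret vector_space "seq_scale :: 'k \<Rightarrow> _"
    by (rule vector_space_seq_scale)
  let ?T = "mat_op p n m"
  let ?B = "(\<lambda>j. ?T (basis_seq j)) ` {..<n}"
  note T = mat_op_in_bounded_ops[OF assms, of n m]
  have p: "0 < p"
    using assms by simp
  have "?T ` lp p \<subseteq> span ?B"
  proof
    fix y assume "y \<in> ?T ` lp p"
    then obtain x where "x \<in> lp p" "y = ?T x"
      by blast
    then have "y = ?T (trunc n x)"
      by (simp add: mat_op_trunc)
    then show "y \<in> span ?B"
      unfolding bounded_ops_trunc[OF assms T]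
      by (simp only:) (rule span_sum, rule span_scale, rule span_base, rule imageI)
  qed
  moreover have "span ?B \<subseteq> ?T ` lp p"
  proof (rule span_minimal)
    show "?B \<subseteq> ?T ` lp p"
      by (auto simp: basis_seq_in_lp)
    show "subspace (?T ` lp p)"
    proof (rule subspaceI)
      show "0 \<in> ?T ` lp p"
        using bounded_ops_zero[OF T] zero_in_lp by (intro image_eqI[of _ _ 0]) auto
      show "u + v \<in> ?T ` lp p" if "u \<in> ?T ` lp p" "v \<in> ?T ` lp p" for u v
        using that by (auto simp: bounded_opsD(2)[OF T, symmetric] lp_triangle(1)[OF assms])
      show "seq_scale c u \<in> ?T ` lp p" if "u \<in> ?T ` lp p" for c u
        using that by (auto simp: bounded_opsD(3)[OF T, symmetric] lp_scale(1)[OF p])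
    qed
  qed
  ultimately show ?thesis
    unfolding finite_rank_ops_def using T by (auto intro!: exI[of _ ?B])
qed

section \<open>The covering\<close>

text \<open>The identity of the overview applied to \<open>x\<close>: both summands have norm at
  most 1 and disjoint supports, so their \<open>p\<close>-th powers add up to at most 2.\<close>

lemma lp_norm_diff_twice_compression_le:
  fixes T :: "(nat \<Rightarrow> 'k::real_normed_field) \<Rightarrow> (nat \<Rightarrow> 'k)"
  assumes "1 \<le> p" "T \<in> bounded_ops p" "op_norm p T \<le> 1" "x \<in> lp p" "lp_norm p x \<le> 1"
  shows "lp_norm p (T x - seq_scale 2 (trunc n (T (trunc n x)))) \<le> 2 powr (1 / p)"
proof -
  have p: "0 < p"
    using assms(1) by simp
  define x' where "x' = x - seq_scale 2 (trunc n x)"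
  have x': "x' \<in> lp p" "lp_norm p x' \<le> 1"
    unfolding x'_def lp_norm_reflection
    by (intro lp_diff lp_scale trunc_in_lp assms p)+
  have Tx': "T x' = T x - seq_scale 2 (T (trunc n x))"
    unfolding x'_def using bounded_opsD(3)[OF assms(2) trunc_in_lp]
    by (simp add: bounded_ops_diff_arg[OF assms(1,2,4)] lp_scale(1)[OF p] trunc_in_lp)
  have b: "lp_norm p (T y) \<le> 1" if "y \<in> lp p" "lp_norm p y \<le> 1" for y
    using lp_norm_le_op_norm[OF assms(2) that] assms(3) by simp
  let ?u = "T x - trunc n (T x)" and ?v = "trunc n (T x')"
  have u: "?u \<in> lp p" "lp_norm p ?u \<le> lp_norm p (T x)"
    by (rule lp_comparison[OF p bounded_opsD(1)[OF assms(2,4)]]; simp add: trunc_def)+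
  have v: "?v \<in> lp p" "lp_norm p ?v \<le> lp_norm p (T x')"
    by (simp_all add: trunc_in_lp lp_norm_trunc_le[OF p bounded_opsD(1)[OF assms(2) x'(1)]])
  \<comment> \<open>At indices below \<open>n\<close> only \<open>?v\<close> contributes, at the
    others only \<open>?u\<close>.\<close>
  have eq: "T x - seq_scale 2 (trunc n (T (trunc n x))) = ?u + ?v"
    by (simp add: Tx') (simp add: trunc_def seq_scale_def fun_eq_iff)
  have "lp_norm p (?u + ?v) powr p = lp_norm p ?u powr p + lp_norm p ?v powr p"
    by (rule lp_norm_add_disjoint_powr[OF p u(1) v(1)]) (simp add: trunc_def)
  also have "\<dots> \<le> 1 powr p + 1 powr p"
    using u v b[OF assms(4,5)] b[OF x'] p
    by (intro add_mono powr_mono2) (auto simp: lp_norm_nonneg)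
  finally have "(\<Sum>i. norm ((?u + ?v) i) powr p) \<le> (2 powr (1 / p)) powr p"
    using p lp_norm_powr[OF p lp_triangle(1)[OF assms(1) u(1) v(1)]] by (simp add: powr_powr)
  then show ?thesis
    unfolding eq by (intro lp_norm_leI p lp_triangle assms u v) auto
qed

text \<open>From \<open>T - PTP = (I - P)T + PT(I - P)\<close>, since \<open>P\<close> is a
  contraction and \<open>T\<close> is bounded. The convergence is pointwise, which suffices to
  recover the norm of \<open>T\<close> at a single near-maximiser.\<close>

lemma compression_tendsto:
  fixes T :: "(nat \<Rightarrow> 'k::real_normed_field) \<Rightarrow> (nat \<Rightarrow> 'k)"
  assumes "1 \<le> p" "T \<in> bounded_ops p" "x \<in> lp p"
  shows "(\<lambda>n. lp_norm p (T x - trunc n (T (trunc n x)))) \<longlonglongrightarrow> 0"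
proof (rule tendsto_sandwich[of "\<lambda>_. 0"])
  have p: "0 < p"
    using assms(1) by simp
  note Tx = bounded_opsD(1)[OF assms(2,3)]
  let ?g = "\<lambda>n. lp_norm p (T x - trunc n (T x)) + op_norm p T * lp_norm p (x - trunc n x)"
  have "lp_norm p (T x - trunc n (T (trunc n x))) \<le> ?g n" for n
  proof -
    have d: "x - trunc n x \<in> lp p"
      by (intro lp_diff assms trunc_in_lp)
    have eq: "T x - trunc n (T (trunc n x)) = (T x - trunc n (T x)) + trunc n (T (x - trunc n x))"
      by (simp add: bounded_ops_diff_arg[OF assms trunc_in_lp] trunc_diff)
    have "lp_norm p (T x - trunc n (T (trunc n x)))
        \<le> lp_norm p (T x - trunc n (T x)) + lp_norm p (trunc n (T (x - trunc n x)))"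
      unfolding eq by (intro lp_triangle lp_diff assms Tx trunc_in_lp)
    also have "\<dots> \<le> ?g n"
      using lp_norm_trunc_le[OF p bounded_opsD(1)[OF assms(2) d], of n]
        lp_norm_le_op_norm_mult[OF p assms(2) d] by simp
    finally show ?thesis .
  qed
  then show "\<forall>\<^sub>F n in sequentially. lp_norm p (T x - trunc n (T (trunc n x))) \<le> ?g n"
    by simp
  show "?g \<longlonglongrightarrow> 0"
    using tendsto_add[OF lp_norm_trunc_tendsto[OF assms(1) Tx]
        tendsto_mult_left[OF lp_norm_trunc_tendsto[OF assms(1,3)], of "op_norm p T"]] by simp
qed (auto simp: lp_norm_nonneg)

text \<open>For fixed \<open>n\<close> there are only finitely many entries, so approximating each
  of them in the dense set \<open>D\<close> approximates the operator uniformly on the unit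
  ball.\<close>

lemma mat_op_approx:
  fixes a :: "nat \<times> nat \<Rightarrow> 'k::{real_normed_field, euclidean_space}"
  assumes "1 \<le> p" "0 < e" and D: "\<And>X :: 'k set. open X \<Longrightarrow> X \<noteq> {} \<Longrightarrow> \<exists>d\<in>D. d \<in> X"
  obtains m where "m \<in> {..<n} \<times> {..<n} \<rightarrow>\<^sub>E D"
    and "\<And>x. x \<in> lp p \<Longrightarrow> lp_norm p x \<le> 1 \<Longrightarrow> lp_norm p (mat_op p n m x - mat_op p n a x) \<le> e"
proof -
  \<comment> \<open>The square has \<open>n * n\<close> entries, each contributing an error of at
    most \<open>d\<close>; adding 1 keeps the denominator positive for \<open>n = 0\<close>.\<close>
  define d where "d = e / (of_nat n * of_nat n + 1)"
  have d: "0 < d" "of_nat n * (of_nat n * d) \<le> e"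
    using assms(2) by (auto simp: d_def field_simps add_pos_nonneg add_nonneg_pos)
  have "\<forall>ij. \<exists>y. y \<in> D \<and> norm (y - a ij) < d"
    using D[of "ball (a ij) d" for ij] d(1) by (force simp: dist_norm norm_minus_commute)
  then obtain f where f: "f ij \<in> D" "norm (f ij - a ij) < d" for ij
    by metis
  \<comment> \<open>Restriction gives the default value that \<open>PiE\<close> requires outside the
    square; \<open>mat_op\<close> never reads it.\<close>
  let ?m = "restrict f ({..<n} \<times> {..<n})"
  have "lp_norm p (mat_op p n ?m x - mat_op p n a x) \<le> e" if x: "x \<in> lp p" "lp_norm p x \<le> 1" for x
  proof -
    have eq: "mat_op p n ?m x - mat_op p n a x = mat_op p n (\<lambda>ij. f ij - a ij) x"
      using x(1) by (simp add: mat_op_def trunc_def fun_eq_iff sum_subtractf algebra_simps)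
    have "lp_norm p (mat_op p n ?m x - mat_op p n a x)
        \<le> (\<Sum>i<n. \<Sum>j<n. norm (f (i, j) - a (i, j))) * lp_norm p x"
      unfolding eq by (rule lp_norm_mat_op_le[OF assms(1) x(1)])
    also have "\<dots> \<le> (\<Sum>i<n. \<Sum>j<n. d) * 1"
      using x(2) d(1) f(2) by (intro mult_mono sum_mono sum_nonneg lp_norm_nonneg) (auto intro: less_imp_le)
    finally show ?thesis
      using d(2) by simp
  qed
  then show ?thesis
    using f(1) by (intro that[of ?m]) auto
qed

theorem corollary3p1:
  fixes p :: real
    and Z :: "((nat \<Rightarrow> 'k::{real_normed_field, euclidean_space}) \<Rightarrow> (nat \<Rightarrow> 'k)) set"
  assumes "1 < p"
    and "module.subspace op_scale Z"
    and "Z \<subseteq> bounded_ops p"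
    and "finite_rank_ops p \<subseteq> Z"
  shows "UBCP Z (op_norm p)"
proof -
  interpret vector_space "op_scale :: 'k \<Rightarrow> _"
    by (rule vector_space_op_scale)
  have p: "1 \<le> p" "0 < p"
    using assms(1) by simp_all
  \<comment> \<open>A quarter of the gap between \<open>2 powr (1 / p)\<close> and 2, positive
    because \<open>1 < p\<close>. The centres will have norm above \<open>2 - 3 * g / 2\<close>,
    hence at least \<open>r + g = 2 - 2 * g\<close>, and lie within
    \<open>2 powr (1 / p) + g / 2 < r\<close> of the points they cover.\<close>
  define g where "g = (2 - 2 powr (1 / p)) / 4"
  define r where "r = 2 powr (1 / p) + g"
  have "2 powr (1 / p) < (2 powr 1 :: real)"
    using assms(1) by (intro powr_less_mono) auto
  then have g: "0 < g" "r + g = 2 - 2 * g" "0 < r"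
    by (auto simp: g_def r_def field_simps add_pos_pos)
  obtain D :: "'k set" where D: "countable D" "\<And>X. open X \<Longrightarrow> X \<noteq> {} \<Longrightarrow> \<exists>d\<in>D. d \<in> X"
    by (rule countable_dense_setE) blast
  define M where "M = (\<Union>n. mat_op p n ` ({..<n} \<times> {..<n} \<rightarrow>\<^sub>E D))"
  have "countable M"
    unfolding M_def by (intro countable_UN countable_image countable_PiE countableI_type D(1)) auto
  have MZ: "M \<subseteq> Z"
    using mat_op_in_finite_rank_ops[OF p(1)] assms(4) by (auto simp: M_def)
  \<comment> \<open>Keeping only centres of norm at least \<open>r + g\<close> separates every ball
    from the ball of radius \<open>g\<close> about 0.\<close>
  define C where "C = (\<lambda>c. (c, r)) ` {c \<in> M. r + g \<le> op_norm p c}"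
  have "0 \<in> Z"
    using subspace_0[OF assms(2)] .
  have cover: "\<exists>c\<in>M. r + g \<le> op_norm p c \<and> op_norm p (T - c) < r"
    if T: "T \<in> Z" "op_norm p T = 1" for T
  proof -
    have TB: "T \<in> bounded_ops p"
      using T(1) assms(3) by blast
    obtain x where x: "x \<in> lp p" "lp_norm p x \<le> 1" "1 - g / 4 < lp_norm p (T x)"
      using op_norm_less_obtain[of "1 - g / 4" p T] T(2) g(1) by auto
    have "\<forall>\<^sub>F n in sequentially. lp_norm p (T x - trunc n (T (trunc n x))) < g / 4"
      using order_tendstoD(2)[OF compression_tendsto[OF p(1) TB x(1)], of "g / 4"] g(1) by simp
    then obtain n where n: "lp_norm p (T x - trunc n (T (trunc n x))) < g / 4"
      by (auto simp: eventually_sequentially)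
    \<comment> \<open>The matrix of \<open>2PTP\<close>; \<open>m\<close> below is its approximation
      with entries in \<open>D\<close>.\<close>
    define a where "a = (\<lambda>(i, j). 2 * T (basis_seq j) i)"
    have a: "mat_op p n a y = seq_scale 2 (trunc n (T (trunc n y)))" if "y \<in> lp p" for y
      unfolding trunc_op_trunc_eq_mat_op[OF p(1) TB that] using that
      by (simp add: mat_op_def a_def trunc_def seq_scale_def fun_eq_iff sum_distrib_left mult.assoc)
    obtain m where m: "m \<in> {..<n} \<times> {..<n} \<rightarrow>\<^sub>E D"
      and approx: "\<And>y. y \<in> lp p \<Longrightarrow> lp_norm p y \<le> 1 \<Longrightarrow>
        lp_norm p (mat_op p n m y - mat_op p n a y) \<le> g / 2"
      using mat_op_approx[OF p(1) half_gt_zero[OF g(1)] D(2)] by blast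
    let ?c = "mat_op p n m"
    note B = bounded_opsD(1)[OF TB] bounded_opsD(1)[OF mat_op_in_bounded_ops[OF p(1)]]
    \<comment> \<open>Near-maximality of \<open>x\<close> and the choice of \<open>n\<close> each
      cost \<open>g / 4\<close>, so \<open>PTP x\<close> has norm above \<open>1 - g / 2\<close>;
      then double.\<close>
    have "2 - g < lp_norm p (mat_op p n a x)"
      using lp_norm_diff_ge[OF p(1) B(1)[OF x(1)] trunc_in_lp[of n "T (trunc n x)"]]
        lp_norm_diff_ge[OF p(1) B(1)[OF x(1)] lp_diff(1)[OF p(1) B(1)[OF x(1)] trunc_in_lp[of n "T (trunc n x)"]]]
        n x(3)
      by (simp add: a[OF x(1)] lp_scale(2)[OF p(2) trunc_in_lp])
    moreover have "lp_norm p (mat_op p n a x) - g / 2 \<le> lp_norm p (?c x)"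
      using lp_diff(2)[OF p(1) B(2)[OF x(1), of n m] lp_diff(1)[OF p(1) B(2)[OF x(1), of n m] B(2)[OF x(1), of n a]]]
        approx[OF x(1,2)] by simp
    moreover have "lp_norm p (?c x) \<le> op_norm p ?c"
      by (rule lp_norm_le_op_norm[OF mat_op_in_bounded_ops[OF p(1)] x(1,2)])
    ultimately have "r + g \<le> op_norm p ?c"
      using g by linarith
    moreover have "op_norm p (T - ?c) \<le> 2 powr (1 / p) + g / 2"
    proof (rule op_norm_leI)
      fix y :: "nat \<Rightarrow> 'k" assume y: "y \<in> lp p" "lp_norm p y \<le> 1"
      have "(T - ?c) y = (T y - mat_op p n a y) - (?c y - mat_op p n a y)"
        by simp
      then have "lp_norm p ((T - ?c) y) \<le>
          lp_norm p (T y - mat_op p n a y) + lp_norm p (?c y - mat_op p n a y)"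
        using lp_diff(2)[OF p(1) lp_diff(1)[OF p(1) B(1)[OF y(1)] B(2)[OF y(1), of n a]]
            lp_diff(1)[OF p(1) B(2)[OF y(1), of n m] B(2)[OF y(1), of n a]]] by simp
      moreover have "lp_norm p (T y - mat_op p n a y) \<le> 2 powr (1 / p)"
        unfolding a[OF y(1)] using T(2)
        by (intro lp_norm_diff_twice_compression_le[OF p(1) TB _ y]) simp
      ultimately show "lp_norm p ((T - ?c) y) \<le> 2 powr (1 / p) + g / 2"
        using approx[OF y] by linarith
    qed
    then have "op_norm p (T - ?c) < r"
      using g(1) by (simp add: r_def)
    ultimately show ?thesis
      using m by (auto simp: M_def)
  qed
  have disj: "nball Z (op_norm p) c r \<inter> nball Z (op_norm p) 0 g = {}"
    if "c \<in> M" "r + g \<le> op_norm p c" for c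
  proof -
    \<comment> \<open>Such a \<open>z\<close> would give \<open>op_norm p c < g + r\<close>.\<close>
    have "False" if "z \<in> Z" "op_norm p (z - c) < r" "op_norm p z < g" for z
      using op_norm_triangle[OF p(1), of z c] that \<open>c \<in> M\<close> MZ assms(3) \<open>r + g \<le> op_norm p c\<close>
      by fastforce
    then show ?thesis
      by (auto simp: nball_def)
  qed
  have zero: "0 \<in> nball Z (op_norm p) 0 g"
    using \<open>0 \<in> Z\<close> g(1) by (simp add: nball_def op_norm_zero)
  show ?thesis
    unfolding UBCP_def
  proof (intro exI[of _ C] conjI)
    show "countable C"
      using \<open>countable M\<close> by (auto simp: C_def intro!: countable_image)
    show "{z \<in> Z. op_norm p z = 1} \<subseteq> (\<Union>(c, r)\<in>C. nball Z (op_norm p) c r)"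
      using cover by (fastforce simp: C_def nball_def)
    \<comment> \<open>The origin lies in the small ball, which misses every covering ball.\<close>
    show "\<forall>(c, r)\<in>C. 0 \<notin> nball Z (op_norm p) c r"
      using disj zero by (auto simp: C_def)
    show "\<exists>R. \<forall>(c, r)\<in>C. r \<le> R"
      by (auto simp: C_def)
    show "\<exists>c0\<in>Z. \<exists>r0>0. 0 \<in> nball Z (op_norm p) c0 r0 \<and>
        (\<forall>(c, r)\<in>C. nball Z (op_norm p) c r \<inter> nball Z (op_norm p) c0 r0 = {})"
      using zero disj g(1) by (intro bexI[of _ 0] exI[of _ g] \<open>0 \<in> Z\<close>) (simp add: C_def)
  qed (use MZ g(3) in \<open>auto simp: C_def\<close>)
qed

end
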